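(* Let $X$, $Y$ be Banach spaces such that $X\hat{\otimes}_\pi Y$ has the Daugavet property. Suppose that the norm of $Y^*$ is Fréchet differentiable at a point $y_0^*\in S_{Y^*}$. Then $X$ has the Daugavet property.
   Context: Banach spaces are real or complex; $X$ and $Y$ are over the same field. $S_{Y^*}$ denotes the unit sphere of the topological dual $Y^*$ of $Y$ (with the dual norm), and $\mathcal{L}(X)$ the space of bounded linear operators on $X$ with the operator norm. A Banach space $X$ has the Daugavet property if $\|\mathrm{Id}+T\|=1+\|T\|$ for every rank-one operator $T\in\mathcal{L}(X)$. The projective tensor product $X\hat{\otimes}_\pi Y$ is the completion of $X\otimes Y$ under $\|u\|_\pi=\inf\{\sum_{i=1}^n\|x_i\|\,\|y_i\| : u=\sum_{i=1}^n x_i\otimes y_i\}$. *)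

theory Defs
  imports "HOL-Analysis.Analysis" "HOL-Library.Function_Algebras"
begin

text \<open>
  The scalar field is a type of the class below, i.e. the reals or the complex numbers with their
  absolute value. Spaces over it are types of class \<open>banach\<close> that carry, besides the real
  structure of the class, an explicit scalar multiplication.
\<close>

class real_or_complex = real_normed_field +
  assumes real_or_complex:
    "\<exists>\<phi>::'a \<Rightarrow> complex.
       (\<forall>a b. \<phi> (a + b) = \<phi> a + \<phi> b) \<and> (\<forall>a b. \<phi> (a * b) = \<phi> a * \<phi> b) \<and>
       (\<forall>r a. \<phi> (r *\<^sub>R a) = r *\<^sub>R \<phi> a) \<and> (\<forall>a. norm (\<phi> a) = norm a) \<and>
       (range \<phi> = \<real> \<or> range \<phi> = UNIV)"

instance real :: real_or_complex
  by standard (rule exI[of _ complex_of_real], auto simp: Reals_def scaleR_conv_of_real)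

instance complex :: real_or_complex
  by standard (rule exI[of _ "\<lambda>z. z"], auto)

locale normed_space_over = vector_space scale
  for scale :: "'k::real_or_complex \<Rightarrow> 'x::real_normed_vector \<Rightarrow> 'x" +
  assumes scale_of_real: "scale (of_real r) x = r *\<^sub>R x"
    and norm_scale: "norm (scale a x) = norm a * norm x"

lemma normed_space_over_scaleR:
  "normed_space_over (scaleR :: real \<Rightarrow> 'x::real_normed_vector \<Rightarrow> 'x)"
  by unfold_locales (simp_all add: algebra_simps)

lemma normed_space_over_field:
  "normed_space_over ((*) :: 'k::real_or_complex \<Rightarrow> 'k \<Rightarrow> 'k)"
  by unfold_locales (simp_all add: algebra_simps norm_mult scaleR_conv_of_real)

text \<open>
  By \<open>scale_of_real\<close>, the bounded linear maps over the scalar field are exactly the bounded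
  real-linear maps that are linear over the scalar field, and the norm of
  type \<open>\<Rightarrow>\<^sub>L\<close> is their operator norm.
\<close>

definition daugavet_property ::
    "('k::real_or_complex \<Rightarrow> 'x::real_normed_vector \<Rightarrow> 'x) \<Rightarrow> bool" where
  "daugavet_property s \<longleftrightarrow>
     (\<forall>T :: 'x \<Rightarrow>\<^sub>L 'x.
        Vector_Spaces.linear s s (blinfun_apply T) \<and>
        vector_space.dim s (range (blinfun_apply T)) = 1 \<longrightarrow>
        norm (id_blinfun + T) = 1 + norm T)"

definition topological_dual ::
    "('k::real_or_complex \<Rightarrow> 'y::real_normed_vector \<Rightarrow> 'y) \<Rightarrow> ('y \<Rightarrow>\<^sub>L 'k) set" where
  "topological_dual s = {f. Vector_Spaces.linear s (*) (blinfun_apply f)}"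

text \<open>
  Frechet differentiability concerns the underlying real structure. A derivative within the real
  subspace \<open>topological_dual s\<close> is only determined on that subspace; that the library
  asks for a bounded linear map on the whole type is no restriction, because a bounded real-linear
  functional on a subspace extends. For real scalars this subspace is the whole type.
\<close>

definition dual_norm_frechet_differentiable_at ::
    "('k::real_or_complex \<Rightarrow> 'y::real_normed_vector \<Rightarrow> 'y) \<Rightarrow> ('y \<Rightarrow>\<^sub>L 'k) \<Rightarrow> bool" where
  "dual_norm_frechet_differentiable_at s f \<longleftrightarrow>
     norm differentiable (at f within topological_dual s)"

text \<open>
  The algebraic tensor product is realised in the standard way as a space of linear functionals on
  the bilinear forms: the elementary tensor of \<open>x\<close> and \<open>y\<close> is
  evaluation at \<open>(x, y)\<close>. Since these functionals live on the type of all functions of two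
  arguments, they are set to 0 off the bilinear forms.
\<close>

definition bilinear_form ::
    "('k::real_or_complex \<Rightarrow> 'x::real_normed_vector \<Rightarrow> 'x) \<Rightarrow>
     ('k \<Rightarrow> 'y::real_normed_vector \<Rightarrow> 'y) \<Rightarrow> ('x \<Rightarrow> 'y \<Rightarrow> 'k) \<Rightarrow> bool" where
  "bilinear_form sx sy B \<longleftrightarrow>
     (\<forall>y. Vector_Spaces.linear sx (*) (\<lambda>x. B x y)) \<and> (\<forall>x. Vector_Spaces.linear sy (*) (B x))"

definition elementary_tensor ::
    "('k::real_or_complex \<Rightarrow> 'x::real_normed_vector \<Rightarrow> 'x) \<Rightarrow>
     ('k \<Rightarrow> 'y::real_normed_vector \<Rightarrow> 'y) \<Rightarrow> 'x \<Rightarrow> 'y \<Rightarrow> ('x \<Rightarrow> 'y \<Rightarrow> 'k) \<Rightarrow> 'k" where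
  "elementary_tensor sx sy x y = (\<lambda>B. if bilinear_form sx sy B then B x y else 0)"

definition scale_fun :: "'k::field \<Rightarrow> ('b \<Rightarrow> 'k) \<Rightarrow> 'b \<Rightarrow> 'k" where
  "scale_fun a u = (\<lambda>B. a * u B)"

definition tensor_space ::
    "('k::real_or_complex \<Rightarrow> 'x::real_normed_vector \<Rightarrow> 'x) \<Rightarrow>
     ('k \<Rightarrow> 'y::real_normed_vector \<Rightarrow> 'y) \<Rightarrow> (('x \<Rightarrow> 'y \<Rightarrow> 'k) \<Rightarrow> 'k) set" where
  "tensor_space sx sy = module.span scale_fun {elementary_tensor sx sy x y | x y. True}"

definition projective_norm ::
    "('k::real_or_complex \<Rightarrow> 'x::real_normed_vector \<Rightarrow> 'x) \<Rightarrow>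
     ('k \<Rightarrow> 'y::real_normed_vector \<Rightarrow> 'y) \<Rightarrow> (('x \<Rightarrow> 'y \<Rightarrow> 'k) \<Rightarrow> 'k) \<Rightarrow> real" where
  "projective_norm sx sy u =
     Inf {\<Sum>i<n. norm (x i) * norm (y i) | (n::nat) x y.
            u = (\<Sum>i<n. elementary_tensor sx sy (x i) (y i))}"

text \<open>
  A completion of a space \<open>V\<close> normed by \<open>p\<close> is a Banach space together with an isometric
  linear embedding of \<open>V\<close> with dense range; it is unique up to isometric isomorphism.
\<close>

definition is_completion ::
    "'v::ab_group_add set \<Rightarrow> ('k::real_or_complex \<Rightarrow> 'v \<Rightarrow> 'v) \<Rightarrow> ('v \<Rightarrow> real) \<Rightarrow>
     ('k \<Rightarrow> 'z::banach \<Rightarrow> 'z) \<Rightarrow> ('v \<Rightarrow> 'z) \<Rightarrow> bool" where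
  "is_completion V s p sz \<iota> \<longleftrightarrow>
     normed_space_over sz \<and>
     (\<forall>u\<in>V. \<forall>v\<in>V. \<iota> (u + v) = \<iota> u + \<iota> v) \<and>
     (\<forall>a. \<forall>u\<in>V. \<iota> (s a u) = sz a (\<iota> u)) \<and>
     (\<forall>u\<in>V. norm (\<iota> u) = p u) \<and>
     closure (\<iota> ` V) = UNIV"

definition is_projective_tensor_product ::
    "('k::real_or_complex \<Rightarrow> 'x::real_normed_vector \<Rightarrow> 'x) \<Rightarrow>
     ('k \<Rightarrow> 'y::real_normed_vector \<Rightarrow> 'y) \<Rightarrow>
     ('k \<Rightarrow> 'z::banach \<Rightarrow> 'z) \<Rightarrow> ((('x \<Rightarrow> 'y \<Rightarrow> 'k) \<Rightarrow> 'k) \<Rightarrow> 'z) \<Rightarrow> bool" where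
  "is_projective_tensor_product sx sy sz \<iota> \<longleftrightarrow>
     is_completion (tensor_space sx sy) scale_fun (projective_norm sx sy) sz \<iota>"

end

theory Submission
  imports Defs
begin

text \<open>
  By Smulian's argument, Frechet differentiability of the dual norm at \<open>y0\<close> says that \<open>y0\<close> strongly
  exposes the unit ball of \<open>Y\<close>: there is \<open>e\<close> in the ball with \<open>y0 e = 1\<close>, and every \<open>y\<close> in the
  ball with \<open>y0 y\<close> close to 1 is close to \<open>e\<close> (\<open>frechet_smooth_point_strongly_exposes\<close>). The slices
  of the ball cut by \<open>y0\<close> have small diameter because the derivative of the norm approximates every
  point of a thin slice, uniformly on the dual sphere; turning this into a bound for a norm in \<open>Y\<close>
  takes norming functionals, that is, the Hahn--Banach theorem. Completeness of \<open>Y\<close> puts \<open>e\<close>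
  into \<open>Y\<close> itself.

  Now let \<open>T\<close> be a rank-one operator on \<open>X\<close>. The operator \<open>S (x \<otimes> y) = y0 y (T x \<otimes> e)\<close> on the tensor
  product again has rank one and its norm is at least that of \<open>T\<close> (\<open>rank_one_tensor_operator\<close>), so
  the Daugavet property of the tensor product gives \<open>\<parallel>Id + S\<parallel> \<ge> 1 + \<parallel>T\<parallel>\<close>. The unit ball of the
  projective tensor product is the closed convex hull of the elementary tensors of unit vectors, so
  \<open>Id + S\<close> almost attains its norm at some \<open>x \<otimes> y\<close> with \<open>\<parallel>x\<parallel> = \<parallel>y\<parallel> = 1\<close>; a scalar of modulus 1 can be
  moved from \<open>y\<close> to \<open>x\<close> so that \<open>y0 y \<ge> 0\<close>. Since
  \<open>\<parallel>x \<otimes> y + S (x \<otimes> y)\<parallel> \<le> 1 + y0 y \<parallel>T\<parallel>\<close>, the number \<open>y0 y\<close> must be close to 1. Hence \<open>y\<close> is close to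
  \<open>e\<close>, and \<open>x \<otimes> y + S (x \<otimes> y)\<close> is close to \<open>(x + T x) \<otimes> e\<close>. Therefore \<open>\<parallel>x + T x\<parallel>\<close> is almost
  \<open>1 + \<parallel>T\<parallel>\<close>, which is the Daugavet equation for \<open>T\<close>.
\<close>

section \<open>Scalars\<close>

text \<open>
  The real part, written through the norm by polarization: the class provides an embedding into
  the complex numbers only up to conjugation, and this form does not depend on a choice.
\<close>

definition re_part :: "'k::real_or_complex \<Rightarrow> real" where
  "re_part a = ((norm (1 + a))\<^sup>2 - (norm a)\<^sup>2 - 1) / 2"

lemma scalar_embedding:
  obtains \<phi> :: "'k::real_or_complex \<Rightarrow> complex"
  where "\<And>a b. \<phi> (a + b) = \<phi> a + \<phi> b" and "\<And>a b. \<phi> (a * b) = \<phi> a * \<phi> b"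
    and "\<And>r a. \<phi> (r *\<^sub>R a) = r *\<^sub>R \<phi> a" and "\<And>a. norm (\<phi> a) = norm a"
    and "range \<phi> = \<real> \<or> range \<phi> = UNIV"
    and "\<phi> 1 = 1" and "\<And>a. Re (\<phi> a) = re_part a" and "inj \<phi>"
proof -
  obtain \<phi> :: "'k \<Rightarrow> complex"
    where \<phi>: "\<And>a b. \<phi> (a + b) = \<phi> a + \<phi> b" "\<And>a b. \<phi> (a * b) = \<phi> a * \<phi> b"
      "\<And>r a. \<phi> (r *\<^sub>R a) = r *\<^sub>R \<phi> a" "\<And>a. norm (\<phi> a) = norm a"
      "range \<phi> = \<real> \<or> range \<phi> = UNIV"
    using real_or_complex by blast
  have "\<phi> 1 * \<phi> 1 = \<phi> 1" "norm (\<phi> 1) = 1"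
    using \<phi>(2)[of 1 1] \<phi>(4)[of 1] by auto
  then have one: "\<phi> 1 = 1" by auto
  have re: "Re (\<phi> a) = re_part a" for a
  proof -
    have "(norm (1 + a))\<^sup>2 = (norm (1 + \<phi> a))\<^sup>2" using \<phi>(1)[of 1 a] \<phi>(4)[of "1 + a"] one by simp
    moreover have "(norm a)\<^sup>2 = (norm (\<phi> a))\<^sup>2" by (simp add: \<phi>(4))
    ultimately show ?thesis
      unfolding re_part_def cmod_power2 by (simp add: power2_eq_square algebra_simps)
  qed
  interpret additive \<phi> by standard (rule \<phi>(1))
  have "inj \<phi>"
  proof (rule injI)
    fix a b assume "\<phi> a = \<phi> b"
    then have "norm (a - b) = 0" using diff[of a b] \<phi>(4)[of "a - b"] by simp
    then show "a = b" by simp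
  qed
  with \<phi> one re that show thesis by blast
qed

lemma re_part_add: "re_part (a + b) = re_part a + re_part b"
proof (rule scalar_embedding)
  fix \<phi> :: "'a \<Rightarrow> complex"
  assume \<phi>: "\<And>a b. \<phi> (a + b) = \<phi> a + \<phi> b" "\<And>a. Re (\<phi> a) = re_part a"
  show ?thesis by (simp add: \<phi>(1) flip: \<phi>(2))
qed

lemma re_part_scaleR: "re_part (r *\<^sub>R a) = r * re_part a"
proof (rule scalar_embedding)
  fix \<phi> :: "'a \<Rightarrow> complex"
  assume \<phi>: "\<And>r a. \<phi> (r *\<^sub>R a) = r *\<^sub>R \<phi> a" "\<And>a. Re (\<phi> a) = re_part a"
  show ?thesis by (simp add: \<phi>(1) flip: \<phi>(2))
qed

lemma re_part_of_real [simp]: "re_part (of_real r :: 'k::real_or_complex) = r"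
proof -
  have "re_part (1 :: 'k) = 1" by (simp add: re_part_def)
  then show ?thesis by (simp add: of_real_def re_part_scaleR)
qed

lemma re_part_minus: "re_part (- a) = - re_part a"
  using re_part_scaleR[of "-1" a] by simp

lemma re_part_diff: "re_part (a - b) = re_part a - re_part b"
  using re_part_add[of a "- b"] by (simp add: re_part_minus)

lemma re_part_le_norm: "re_part a \<le> norm a"
proof (rule scalar_embedding)
  fix \<phi> :: "'a \<Rightarrow> complex"
  assume \<phi>: "\<And>a. norm (\<phi> a) = norm a" "\<And>a. Re (\<phi> a) = re_part a"
  show ?thesis using complex_Re_le_cmod[of "\<phi> a"] by (simp add: \<phi>)
qed

lemma eq_one_if_re_part_ge_norm:
  assumes "norm a \<le> 1" and "re_part a \<ge> 1"
  shows "a = 1"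
proof (rule scalar_embedding)
  fix \<phi> :: "'a \<Rightarrow> complex"
  assume \<phi>: "\<And>a. norm (\<phi> a) = norm a" "\<phi> 1 = 1" "\<And>a. Re (\<phi> a) = re_part a" "inj \<phi>"
  have "Re (\<phi> a) \<le> cmod (\<phi> a)" by (rule complex_Re_le_cmod)
  with assms have re: "Re (\<phi> a) = 1" and "cmod (\<phi> a) = 1" by (simp_all add: \<phi>)
  then have "Im (\<phi> a) = 0" using cmod_power2[of "\<phi> a"] by simp
  with re have "\<phi> a = \<phi> 1" by (simp add: complex_eq_iff \<phi>(2))
  with \<phi>(4) show ?thesis by (simp add: inj_eq)
qed

text \<open>
  Taking \<open>j = 0\<close> for real and \<open>j = \<i>\<close> for complex scalars treats both fields at once when a real
  functional is turned into one over the scalar field.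
\<close>

lemma scalar_decomposition:
  obtains j :: "'k::real_or_complex"
  where "j = 0 \<or> j * j = - 1" and "re_part j = 0"
    and "\<And>a. of_real (re_part a) - of_real (re_part (j * a)) * j = a"
proof (rule scalar_embedding)
  fix \<phi> :: "'k \<Rightarrow> complex"
  assume \<phi>: "\<And>a b. \<phi> (a + b) = \<phi> a + \<phi> b" "\<And>a b. \<phi> (a * b) = \<phi> a * \<phi> b"
      "\<And>r a. \<phi> (r *\<^sub>R a) = r *\<^sub>R \<phi> a"
      "range \<phi> = \<real> \<or> range \<phi> = UNIV"
      "\<phi> 1 = 1" "\<And>a. Re (\<phi> a) = re_part a" "inj \<phi>"
  interpret additive \<phi> by standard (rule \<phi>(1))
  have of_real: "\<phi> (of_real r) = of_real r" for r
    by (simp add: of_real_def \<phi>(3,5))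
  from \<phi>(4) show thesis
  proof
    assume range: "range \<phi> = \<real>"
    have real: "of_real (re_part a) = a" for a :: 'k
    proof -
      have "\<phi> a \<in> \<real>" using range by blast
      then have "\<phi> (of_real (re_part a)) = \<phi> a"
        by (simp add: of_real complex_is_Real_iff complex_eq_iff \<phi>(6))
      with \<phi>(7) show ?thesis by (simp add: inj_eq)
    qed
    show thesis using re_part_of_real[of 0, where 'k = 'k] by (intro that[of 0]) (simp_all add: real)
  next
    assume "range \<phi> = UNIV"
    then obtain j where j: "\<phi> j = \<i>" by (metis surjD)
    have jj: "j * j = - 1"
    proof -
      have "\<phi> (j * j) = \<phi> (- 1)" by (simp add: \<phi>(2,5) minus j)
      with \<phi>(7) show ?thesis by (simp add: inj_eq)
    qed
    have "of_real (re_part a) - of_real (re_part (j * a)) * j = a" for a :: 'k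
    proof -
      have "\<phi> (of_real (re_part a) - of_real (re_part (j * a)) * j) = \<phi> a"
        by (simp add: add diff \<phi>(2) of_real j complex_eq_iff flip: \<phi>(6))
      with \<phi>(7) show ?thesis by (simp add: inj_eq)
    qed
    with jj that[of j] show thesis by (simp add: j flip: \<phi>(6))
  qed
qed

lemma rotation_to_norm:
  fixes a :: "'k::real_or_complex"
  obtains \<theta> where "norm \<theta> = 1" and "\<theta> * a = of_real (norm a)"
proof (cases "a = 0")
  case True
  with that[of 1] show thesis by simp
next
  case False
  with that[of "of_real (norm a) / a"] show thesis by (simp add: norm_divide)
qed

text \<open>
  The image of the scalar field in the complex numbers is closed, hence the field is complete. This
  is what lets scalar-valued functionals extend from a dense subspace to its completion.
\<close>

instance real_or_complex \<subseteq> complete_space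
proof
  fix X :: "nat \<Rightarrow> 'a" assume X: "Cauchy X"
  show "convergent X"
  proof (rule scalar_embedding)
    fix \<phi> :: "'a \<Rightarrow> complex"
    assume \<phi>: "\<And>a b. \<phi> (a + b) = \<phi> a + \<phi> b" "\<And>a. norm (\<phi> a) = norm a"
      "range \<phi> = \<real> \<or> range \<phi> = UNIV"
    interpret additive \<phi> by standard (rule \<phi>(1))
    have dist: "dist (\<phi> a) (\<phi> b) = dist a b" for a b
      by (simp add: dist_norm \<phi>(2) flip: diff)
    have "Cauchy (\<lambda>n. \<phi> (X n))" using X by (simp add: Cauchy_def dist)
    then obtain c where c: "(\<lambda>n. \<phi> (X n)) \<longlonglongrightarrow> c" by (auto simp: Cauchy_convergent_iff convergent_def)
    have "closed (range \<phi>)" using \<phi>(3) by (auto simp: closed_complex_Reals)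
    then have "c \<in> range \<phi>" by (rule closed_sequentially[OF _ _ c]) simp
    then obtain a where "c = \<phi> a" by blast
    with c have "X \<longlonglongrightarrow> a" by (simp add: LIMSEQ_def dist)
    then show ?thesis by (auto simp: convergent_def)
  qed
qed

section \<open>The Hahn--Banach theorem\<close>

text \<open>
  Linear functionals are the minimal elements among the sublinear ones, ordered pointwise, so
  Zorn's lemma applied to sublinear functionals below a given one yields a linear functional
  without partial functionals on subspaces. The inequality for scaling is the half that passes to
  infima; equality follows by \<open>sublinear_scale\<close>.
\<close>

definition sublinear :: "('x::real_vector \<Rightarrow> real) \<Rightarrow> bool" where
  "sublinear p \<longleftrightarrow> (\<forall>x y. p (x + y) \<le> p x + p y) \<and> (\<forall>t\<ge>0. \<forall>x. p (t *\<^sub>R x) \<le> t * p x)"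

lemma sublinear_subadditive: "sublinear p \<Longrightarrow> p (x + y) \<le> p x + p y"
  and sublinear_scale_le: "sublinear p \<Longrightarrow> t \<ge> 0 \<Longrightarrow> p (t *\<^sub>R x) \<le> t * p x"
  by (simp_all add: sublinear_def)

lemma sublinear_zero: "sublinear p \<Longrightarrow> p 0 = 0"
  using sublinear_subadditive[of p 0 0] sublinear_scale_le[of p 0 0] by simp

lemma sublinear_lower_bound: "sublinear p \<Longrightarrow> - p (- x) \<le> p x"
  using sublinear_subadditive[of p x "- x"] sublinear_zero[of p] by simp

lemma sublinear_scale:
  assumes p: "sublinear p" and t: "t \<ge> 0"
  shows "p (t *\<^sub>R x) = t * p x"
proof (cases "t = 0")
  case False
  with t have "t > 0" by simp
  with sublinear_scale_le[OF p, of "1 / t" "t *\<^sub>R x"] have "t * p x \<le> p (t *\<^sub>R x)"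
    by (simp add: field_simps)
  with sublinear_scale_le[OF p t] show ?thesis by (simp add: order_antisym)
qed (simp add: sublinear_zero[OF p])

text \<open>
  The infimum below is the largest sublinear functional under \<open>p\<close> that takes the value
  \<open>- p x\<close> at \<open>- x\<close>. It serves twice: it makes a minimal sublinear functional odd, and
  applied to the norm it prescribes the value at one vector.
\<close>

lemma sublinear_reduction:
  assumes p: "sublinear p"
  obtains q where "sublinear q" and "\<And>z. q z \<le> p z" and "q (- x) \<le> - p x"
proof
  let ?g = "\<lambda>z t. p (z + t *\<^sub>R x) - t * p x"
  let ?q = "\<lambda>z. INF t\<in>{0..}. ?g z t"
  have bdd: "bdd_below (?g z ` {0..})" for z
  proof (rule bdd_belowI2)
    fix t :: real assume "t \<in> {0..}"
    then show "- p (- z) \<le> ?g z t"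
      using sublinear_subadditive[OF p, of "z + t *\<^sub>R x" "- z"] sublinear_scale[OF p, of t x]
      by simp
  qed
  have le: "?q z \<le> ?g z t" if "t \<ge> 0" for z t
    using that by (intro cINF_lower[OF bdd]) simp
  have ge: "c \<le> ?q z" if "\<And>t. t \<ge> 0 \<Longrightarrow> c \<le> ?g z t" for c z
    using that by (intro cINF_greatest) auto
  show q_le: "?q z \<le> p z" for z using le[of 0 z] by simp
  show "?q (- x) \<le> - p x" using le[of 1 "- x"] by (simp add: sublinear_zero[OF p])
  have add: "?q (z + w) \<le> ?q z + ?q w" for z w
  proof -
    have "?q (z + w) - ?g w t' \<le> ?g z t" if "t \<ge> 0" "t' \<ge> 0" for t t'
    proof -
      have "?q (z + w) \<le> ?g (z + w) (t + t')" using that by (intro le) simp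
      also have "\<dots> \<le> ?g z t + ?g w t'"
        using sublinear_subadditive[OF p, of "z + t *\<^sub>R x" "w + t' *\<^sub>R x"]
        by (simp add: algebra_simps)
      finally show ?thesis by simp
    qed
    then have "?q (z + w) - ?g w t' \<le> ?q z" if "t' \<ge> 0" for t'
      using that by (intro ge) auto
    then have "?q (z + w) - ?q z \<le> ?g w t'" if "t' \<ge> 0" for t'
      using that by (smt (verit))
    then have "?q (z + w) - ?q z \<le> ?q w" by (intro ge) auto
    then show ?thesis by simp
  qed
  have scale: "?q (s *\<^sub>R z) \<le> s * ?q z" if s: "s \<ge> 0" for s z
  proof (cases "s = 0")
    case True
    then show ?thesis using q_le[of 0] by (simp add: sublinear_zero[OF p])
  next
    case False
    with s have s: "s > 0" by simp
    have "?q (s *\<^sub>R z) / s \<le> ?g z t" if "t \<ge> 0" for t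
    proof -
      have "?q (s *\<^sub>R z) \<le> ?g (s *\<^sub>R z) (s * t)" using that s by (intro le) simp
      also have "\<dots> \<le> s * ?g z t"
        using sublinear_scale_le[OF p, of s "z + t *\<^sub>R x"] s by (simp add: algebra_simps)
      finally show ?thesis using s by (simp add: field_simps)
    qed
    then have "?q (s *\<^sub>R z) / s \<le> ?q z" by (intro ge) auto
    then show ?thesis using s by (simp add: field_simps)
  qed
  show "sublinear ?q" unfolding sublinear_def using add scale by blast
qed

text \<open>
  A minimal \<open>p\<close> coincides with each of its reductions, so \<open>p (- x) \<le> - p x\<close>. An odd subadditive
  function is also superadditive.
\<close>

lemma minimal_sublinear_is_linear:
  assumes p: "sublinear p" and min: "\<And>q. sublinear q \<Longrightarrow> (\<And>x. q x \<le> p x) \<Longrightarrow> q = p"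
  shows "linear p"
proof -
  have odd: "p (- x) = - p x" for x
  proof -
    obtain q where "sublinear q" "\<And>z. q z \<le> p z" and q: "q (- x) \<le> - p x"
      using sublinear_reduction[OF p, where x = x] by blast
    then have "q = p" by (intro min)
    with q show ?thesis using sublinear_lower_bound[OF p, of "- x"] by simp
  qed
  have add: "p (x + y) = p x + p y" for x y
    using sublinear_subadditive[OF p, of x y] sublinear_subadditive[OF p, of "- x" "- y"]
      odd[of x] odd[of y] odd[of "x + y"] by simp
  moreover have "p (t *\<^sub>R x) = t *\<^sub>R p x" for t x
  proof (cases "t \<ge> 0")
    case False
    then have "p ((- t) *\<^sub>R x) = (- t) * p x" by (intro sublinear_scale[OF p]) simp
    then show ?thesis using odd[of "t *\<^sub>R x"] by simp
  qed (simp add: sublinear_scale[OF p])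
  ultimately show ?thesis by (intro linearI)
qed

text \<open>
  Sublinear functionals below \<open>q\<close> satisfy \<open>p x \<ge> - q (- x)\<close>, so the infimum is finite. The chain
  condition enters in subadditivity: two members have a common lower bound in the chain.
\<close>

lemma INF_chain_sublinear:
  assumes ne: "C \<noteq> {}" and sub: "\<And>p. p \<in> C \<Longrightarrow> sublinear p" and below: "\<And>p. p \<in> C \<Longrightarrow> p \<le> q"
    and chain: "\<And>p p'. p \<in> C \<Longrightarrow> p' \<in> C \<Longrightarrow> p \<le> p' \<or> p' \<le> p"
  shows "sublinear (\<lambda>x. INF p\<in>C. p x)" and "\<And>p x. p \<in> C \<Longrightarrow> (INF p\<in>C. p x) \<le> p x"
proof -
  let ?u = "\<lambda>x. INF p\<in>C. p x"
  have bdd: "bdd_below ((\<lambda>p. p x) ` C)" for x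
  proof (rule bdd_belowI2)
    fix p assume "p \<in> C"
    then show "- q (- x) \<le> p x"
      using sublinear_lower_bound[OF sub, of p x] le_funD[OF below, of p "- x"] by simp
  qed
  show le: "?u x \<le> p x" if "p \<in> C" for p x
    using that by (intro cINF_lower[OF bdd])
  have ge: "c \<le> ?u x" if "\<And>p. p \<in> C \<Longrightarrow> c \<le> p x" for c x
    using that ne by (intro cINF_greatest)
  have add: "?u (x + y) \<le> ?u x + ?u y" for x y
  proof -
    have "?u (x + y) - p' y \<le> p x" if pp: "p \<in> C" "p' \<in> C" for p p'
    proof -
      obtain m where m: "m \<in> C" "m \<le> p" "m \<le> p'" using chain[OF pp] pp by blast
      have "?u (x + y) \<le> m x + m y"
        using le[OF m(1)] sublinear_subadditive[OF sub[OF m(1)]] order_trans by blast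
      also have "\<dots> \<le> p x + p' y" using m by (intro add_mono) (auto simp: le_fun_def)
      finally show ?thesis by simp
    qed
    then have "?u (x + y) - p' y \<le> ?u x" if "p' \<in> C" for p' using that by (intro ge) auto
    then have "?u (x + y) - ?u x \<le> p' y" if "p' \<in> C" for p' using that by (smt (verit))
    then have "?u (x + y) - ?u x \<le> ?u y" by (intro ge) auto
    then show ?thesis by simp
  qed
  have scale: "?u (s *\<^sub>R x) \<le> s * ?u x" if s: "s \<ge> 0" for s x
  proof (cases "s = 0")
    case True
    obtain p where p: "p \<in> C" using ne by blast
    then have "?u 0 \<le> 0" using le[OF p, of 0] sublinear_zero[OF sub[OF p]] by simp
    with True show ?thesis by simp
  next
    case False
    with s have s: "s > 0" by simp
    have "?u (s *\<^sub>R x) / s \<le> p x" if "p \<in> C" for p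
      using le[OF that, of "s *\<^sub>R x"] sublinear_scale[OF sub[OF that], of s x] s
      by (simp add: field_simps)
    then have "?u (s *\<^sub>R x) / s \<le> ?u x" by (intro ge)
    then show ?thesis using s by (simp add: field_simps)
  qed
  show "sublinear ?u" unfolding sublinear_def using add scale by blast
qed

lemma Hahn_Banach_sublinear:
  assumes q: "sublinear q"
  obtains f where "linear f" and "\<And>x. f x \<le> q x"
proof -
  let ?A = "{p. sublinear p \<and> p \<le> q}"
  have "\<exists>m\<in>?A. \<forall>a\<in>?A. m \<ge> a \<longrightarrow> a = m"
  proof (rule predicate_Zorn)
    show "partial_order_on ?A (relation_of (\<ge>) ?A)"
      by (rule partial_order_on_relation_ofI) auto
    fix C assume C: "C \<in> Chains (relation_of (\<ge>) ?A)"
    then have sub: "sublinear p" and below: "p \<le> q" if "p \<in> C" for p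
      using that by (auto simp: Chains_def relation_of_def)
    have chain: "p \<le> p' \<or> p' \<le> p" if "p \<in> C" "p' \<in> C" for p p'
      using C that by (auto simp: Chains_def relation_of_def)
    show "\<exists>u\<in>?A. \<forall>a\<in>C. a \<ge> u"
    proof (cases "C = {}")
      case True
      with q show ?thesis by auto
    next
      case False
      let ?u = "\<lambda>x. INF p\<in>C. p x"
      have u: "sublinear ?u"
        by (rule INF_chain_sublinear(1)[where q = q]) (use False sub below chain in auto)
      have "?u x \<le> p x" if "p \<in> C" for p x
        by (rule INF_chain_sublinear(2)[where q = q]) (use False sub below chain that in auto)
      then have le: "?u \<le> p" if "p \<in> C" for p using that by (simp add: le_fun_def)
      moreover obtain p where "p \<in> C" using False by blast
      ultimately have "?u \<le> q" using below order_trans by blast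
      with u le show ?thesis by blast
    qed
  qed
  then obtain m where m: "sublinear m" "m \<le> q" and min: "\<And>p. p \<in> ?A \<Longrightarrow> p \<le> m \<Longrightarrow> p = m"
    by blast
  have "linear m"
    using m(1)
  proof (rule minimal_sublinear_is_linear)
    fix p assume "sublinear p" "\<And>x. p x \<le> m x"
    then show "p = m" using m(2) by (intro min) (auto simp: le_fun_def intro: order_trans)
  qed
  with m(2) that show thesis by (simp add: le_fun_def)
qed

text \<open>
  Reducing the norm at \<open>v\<close> first gives a sublinear bound that is \<open>- norm v\<close> at \<open>- v\<close>; every linear
  functional below it is then at least \<open>norm v\<close> at \<open>v\<close>.
\<close>

lemma real_norming_functional:
  fixes v :: "'x::real_normed_vector"
  obtains f where "linear f" and "\<And>x. f x \<le> norm x" and "f v = norm v"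
proof -
  have "sublinear (norm :: 'x \<Rightarrow> real)" by (simp add: sublinear_def norm_triangle_ineq)
  then obtain q where q: "sublinear q" "\<And>x. q x \<le> norm x" "q (- v) \<le> - norm v"
    using sublinear_reduction[where x = v] by blast
  obtain f where f: "linear f" "\<And>x. f x \<le> q x"
    using Hahn_Banach_sublinear[OF q(1)] by blast
  have "f x \<le> norm x" for x using f(2) q(2) order_trans by blast
  moreover from this[of v] have "f v = norm v"
    using f(2)[of "- v"] q(3) linear_neg[OF f(1), of v] by simp
  ultimately show thesis using f(1) that by blast
qed

text \<open>
  A real functional is the real part of the functional
  \<open>f x - j f (j x)\<close> over the scalar field, with \<open>j\<close> the imaginary unit; rotating \<open>h x\<close> onto the
  positive axis shows that the bound is inherited.
\<close>

lemma functional_with_real_part: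
  fixes s :: "'k::real_or_complex \<Rightarrow> 'x::real_normed_vector \<Rightarrow> 'x"
  assumes s: "normed_space_over s" and f: "linear f" and le: "\<And>x. f x \<le> norm x"
  obtains h where "Vector_Spaces.linear s (*) h" and "\<And>x. re_part (h x) = f x"
    and "\<And>x. norm (h x) \<le> norm x"
proof -
  interpret S: normed_space_over s by (rule s)
  interpret K: normed_space_over "(*) :: 'k \<Rightarrow> 'k \<Rightarrow> 'k" by (rule normed_space_over_field)
  interpret f: linear f by (rule f)
  obtain j :: 'k where j: "j = 0 \<or> j * j = - 1" "re_part j = 0"
    and dec: "\<And>a. of_real (re_part a) - of_real (re_part (j * a)) * j = a"
    by (rule scalar_decomposition) blast
  define h where "h x = of_real (f x) - j * of_real (f (s j x))" for x
  have add: "h (x + y) = h x + h y" for x y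
    by (simp add: h_def f.add S.scale_right_distrib algebra_simps)
  have real: "h (s (of_real r) x) = of_real r * h x" for r x
  proof -
    have "s j (s (of_real r) x) = s (of_real r) (s j x)" by (simp add: mult.commute)
    then show ?thesis unfolding h_def by (simp only: S.scale_of_real f.scale) (simp add: algebra_simps)
  qed
  have imag: "h (s j x) = j * h x" for x
  proof (cases "j = 0")
    case False
    with j have jj: "j * j = - 1" by simp
    then have "s (j * j) x = - x" by simp
    moreover have "j * (j * a) = - a" for a using jj mult.assoc[of j j a] by simp
    ultimately show ?thesis by (simp add: h_def f.neg right_diff_distrib)
  qed (simp add: h_def f.zero)
  have scale: "h (s a x) = a * h x" for a x
  proof -
    let ?b = "re_part a" and ?c = "- re_part (j * a)"
    have a: "of_real ?b + of_real ?c * j = a" using dec[of a] by simp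
    have "h (s a x) = h (s (of_real ?b) x + s (of_real ?c) (s j x))"
      unfolding S.scale_left_distrib[symmetric] S.scale_scale a ..
    also have "\<dots> = (of_real ?b + of_real ?c * j) * h x"
      unfolding add real imag by (simp add: algebra_simps)
    finally show ?thesis unfolding a .
  qed
  have re: "re_part (h x) = f x" for x
  proof -
    have "re_part (j * of_real r) = 0" for r
      using re_part_scaleR[of r j] j(2) by (simp add: scaleR_conv_of_real mult.commute)
    then show ?thesis by (simp add: h_def re_part_diff)
  qed
  have norm: "norm (h x) \<le> norm x" for x
  proof -
    obtain \<theta> where \<theta>: "norm \<theta> = 1" "\<theta> * h x = of_real (norm (h x))" by (rule rotation_to_norm)
    have "norm (h x) = re_part (h (s \<theta> x))" by (simp add: scale \<theta>)
    also have "\<dots> \<le> norm (s \<theta> x)" by (simp only: re le)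
    finally show ?thesis by (simp add: S.norm_scale \<theta>)
  qed
  have "Vector_Spaces.linear s (*) h" by unfold_locales (simp_all add: add scale)
  with re norm that show thesis by blast
qed

section \<open>Frechet smooth points of the dual ball\<close>

lemma linear_over_add: "Vector_Spaces.linear s s' f \<Longrightarrow> f (x + y) = f x + f y"
  and linear_over_scale: "Vector_Spaces.linear s s' f \<Longrightarrow> f (s a x) = s' a (f x)"
  by (simp_all add: module_hom.add module_hom.scale flip: module_hom_iff_linear)

lemma linear_overI:
  assumes "normed_space_over s" and "normed_space_over s'"
    and "\<And>x y. f (x + y) = f x + f y" and "\<And>a x. f (s a x) = s' a (f x)"
  shows "Vector_Spaces.linear s s' f"
  using assms
  by (simp add: module_hom_def module_hom_axioms_def module_iff_vector_space normed_space_over_def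
      flip: module_hom_iff_linear)

lemma bounded_linear_overI:
  assumes s: "normed_space_over s" and s': "normed_space_over s'"
    and f: "Vector_Spaces.linear s s' f" and le: "\<And>x. norm (f x) \<le> C * norm x"
  shows "bounded_linear f"
proof (rule bounded_linear_intro)
  show "f (x + y) = f x + f y" for x y by (rule linear_over_add[OF f])
  show "f (r *\<^sub>R x) = r *\<^sub>R f x" for r x
    using linear_over_scale[OF f, of "of_real r" x]
    by (simp add: normed_space_over.scale_of_real[OF s] normed_space_over.scale_of_real[OF s'])
  show "norm (f x) \<le> norm x * C" for x using le[of x] by (simp add: mult.commute)
qed

lemma norming_functional:
  fixes s :: "'k::real_or_complex \<Rightarrow> 'x::real_normed_vector \<Rightarrow> 'x"
  assumes s: "normed_space_over s"
  obtains g where "g \<in> topological_dual s" and "norm g \<le> 1" and "re_part (g v) = norm v"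
proof -
  obtain f where f: "linear f" "\<And>x. f x \<le> norm x" "f v = norm v"
    using real_norming_functional[where v = v] by blast
  obtain h where h: "Vector_Spaces.linear s (*) h" "\<And>x. re_part (h x) = f x"
      "\<And>x. norm (h x) \<le> norm x"
    using functional_with_real_part[OF s f(1,2)] by blast
  have "bounded_linear h"
    by (rule bounded_linear_overI[OF s normed_space_over_field h(1), of 1]) (simp add: h(3))
  then have app: "blinfun_apply (Blinfun h) = h" by (rule bounded_linear_Blinfun_apply)
  show thesis
  proof (rule that[of "Blinfun h"])
    show "norm (Blinfun h) \<le> 1" by (rule norm_blinfun_bound) (simp_all add: app h(3))
  qed (simp_all add: topological_dual_def app h f)
qed

lemma topological_dual_add_scaleR:
  assumes s: "normed_space_over s" and f: "f \<in> topological_dual s" and g: "g \<in> topological_dual s"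
  shows "f + r *\<^sub>R g \<in> topological_dual s"
proof -
  have f': "Vector_Spaces.linear s (*) f" and g': "Vector_Spaces.linear s (*) g"
    using f g by (simp_all add: topological_dual_def)
  have "Vector_Spaces.linear s (*) (f + r *\<^sub>R g)"
    by (rule linear_overI[OF s normed_space_over_field])
      (simp_all add: blinfun.add_left blinfun.add_right blinfun.scaleR_left
        linear_over_scale[OF f'] linear_over_scale[OF g'] algebra_simps)
  then show ?thesis by (simp add: topological_dual_def)
qed

text \<open>
  For small \<open>h\<close> in the dual and \<open>y\<close> in the unit ball, \<open>re_part ((f + h) y) \<le> norm (f + h) \<le> 1 + D h + \<epsilon> \<parallel>h\<parallel>\<close>,
  where \<open>D\<close> is the derivative, so on a thin slice \<open>re_part (h y)\<close> exceeds \<open>D h\<close> by little. Applying this to \<open>h\<close> at \<open>y\<close>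
  and to \<open>- h\<close> at \<open>y'\<close> removes \<open>D\<close> and bounds \<open>re_part (h (y - y'))\<close>, with \<open>h\<close> a small multiple of
  a functional that norms \<open>y - y'\<close>.
\<close>

lemma slice_diameter_small:
  fixes s :: "'k::real_or_complex \<Rightarrow> 'y::real_normed_vector \<Rightarrow> 'y"
  assumes s: "normed_space_over s" and f: "f \<in> topological_dual s" "norm f = 1"
    and diff: "dual_norm_frechet_differentiable_at s f" and \<eta>: "\<eta> > 0"
  obtains \<delta> where "\<delta> > 0"
    and "\<And>y y'. norm y \<le> 1 \<Longrightarrow> norm y' \<le> 1 \<Longrightarrow> re_part (f y) \<ge> 1 - \<delta> \<Longrightarrow> re_part (f y') \<ge> 1 - \<delta>
           \<Longrightarrow> norm (y - y') \<le> \<eta>"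
proof -
  obtain D where D: "(norm has_derivative D) (at f within topological_dual s)"
    using diff by (auto simp: dual_norm_frechet_differentiable_at_def differentiable_def)
  then interpret D: bounded_linear D by (rule has_derivative_bounded_linear)
  \<comment> \<open>the error \<open>\<epsilon> * t\<close> occurs four times: for each of the two points, once from the derivative and
      once from the width of the slice\<close>
  define \<epsilon> where "\<epsilon> = \<eta> / 4"
  have \<epsilon>: "\<epsilon> > 0" using \<eta> by (simp add: \<epsilon>_def)
  obtain d where d: "d > 0"
    and deriv: "\<And>h. h \<in> topological_dual s \<Longrightarrow> norm (h - f) < d \<Longrightarrow>
          norm (norm h - norm f - D (h - f)) \<le> \<epsilon> * norm (h - f)"
    using D \<epsilon> unfolding has_derivative_within_alt by blast
  define t where "t = d / 2"
  have t: "t > 0" "t < d" using d by (simp_all add: t_def)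
  show thesis
  proof (rule that[of "\<epsilon> * t"])
    show "\<epsilon> * t > 0" using \<epsilon> t by simp
    fix y y'
    assume y: "norm y \<le> 1" "norm y' \<le> 1"
      and slice: "re_part (f y) \<ge> 1 - \<epsilon> * t" "re_part (f y') \<ge> 1 - \<epsilon> * t"
    obtain g where g: "g \<in> topological_dual s" "norm g \<le> 1" "re_part (g (y - y')) = norm (y - y')"
      using norming_functional[OF s] by blast
    have key: "r * re_part (g z) \<le> r * D g + 2 * (\<epsilon> * t)"
      if r: "\<bar>r\<bar> = t" and z: "norm z \<le> 1" and fz: "re_part (f z) \<ge> 1 - \<epsilon> * t" for r z
    proof -
      have small: "norm (r *\<^sub>R g) \<le> t" using r g(2) t(1) by (simp add: mult_left_le)
      have "norm (f + r *\<^sub>R g) - 1 - r * D g \<le> \<epsilon> * norm (r *\<^sub>R g)"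
        using deriv[OF topological_dual_add_scaleR[OF s f(1) g(1), of r]] small t(2) f(2)
        by (simp add: D.scaleR)
      also have "\<dots> \<le> \<epsilon> * t" using small \<epsilon> by (intro mult_left_mono) auto
      finally have upper: "norm (f + r *\<^sub>R g) \<le> 1 + r * D g + \<epsilon> * t" by simp
      have "re_part (f z) + r * re_part (g z) = re_part ((f + r *\<^sub>R g) z)"
        by (simp add: blinfun.add_left blinfun.scaleR_left re_part_add re_part_scaleR)
      also have "\<dots> \<le> norm ((f + r *\<^sub>R g) z)" by (rule re_part_le_norm)
      also have "\<dots> \<le> norm (f + r *\<^sub>R g) * norm z" by (rule norm_blinfun)
      also have "\<dots> \<le> norm (f + r *\<^sub>R g)" using z by (simp add: mult_left_le)
      finally show ?thesis using upper fz by linarith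
    qed
    have "t * norm (y - y') = t * re_part (g y) - t * re_part (g y')"
      unfolding g(3)[symmetric] by (simp add: blinfun.diff_right re_part_diff algebra_simps)
    also have "\<dots> \<le> 4 * (\<epsilon> * t)"
      using key[of t y] key[of "- t" y'] y slice t by simp
    finally show "norm (y - y') \<le> \<eta>" using t(1) by (simp add: \<epsilon>_def field_simps)
  qed
qed

lemma slice_nonempty:
  fixes s :: "'k::real_or_complex \<Rightarrow> 'y::real_normed_vector \<Rightarrow> 'y"
  assumes s: "normed_space_over s" and f: "f \<in> topological_dual s" "norm f = 1" and \<delta>: "\<delta> > 0"
  obtains y where "norm y \<le> 1" and "re_part (f y) \<ge> 1 - \<delta>"
proof (rule ccontr)
  note point = that
  interpret normed_space_over s by (rule s)
  have lin: "Vector_Spaces.linear s (*) f" using f(1) by (simp add: topological_dual_def)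
  assume none: "\<not> thesis"
  have less: "re_part (f y) < 1 - \<delta>" if "norm y \<le> 1" for y
    using none point[OF that] by force
  have "norm (f y) \<le> (1 - \<delta>) * norm y" for y
  proof (cases "y = 0")
    case False
    obtain \<theta> where \<theta>: "norm \<theta> = 1" "\<theta> * f y = of_real (norm (f y))" by (rule rotation_to_norm)
    let ?z = "s (of_real (1 / norm y)) (s \<theta> y)"
    have "f ?z = of_real (norm (f y) / norm y)"
      by (simp only: linear_over_scale[OF lin] \<theta>) simp
    moreover have "norm ?z \<le> 1" using False by (simp only: norm_scale \<theta>) (simp add: norm_divide)
    ultimately have "norm (f y) / norm y < 1 - \<delta>" using less[of ?z] by (metis re_part_of_real)
    then show ?thesis using False by (simp add: field_simps)
  qed simp
  moreover have "0 \<le> 1 - \<delta>" using less[of 0] re_part_of_real[of 0, where 'k = 'k] by simp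
  ultimately have "norm f \<le> 1 - \<delta>" by (intro norm_blinfun_bound)
  with f \<delta> show False by simp
qed

text \<open>
  The slices are nonempty closed sets whose diameters tend to 0, so by completeness they shrink to
  a point. The value of \<open>f\<close> there has norm at most 1 and real part at least 1.
\<close>

lemma frechet_smooth_point_strongly_exposes:
  fixes s :: "'k::real_or_complex \<Rightarrow> 'y::banach \<Rightarrow> 'y"
  assumes s: "normed_space_over s" and f: "f \<in> topological_dual s" "norm f = 1"
    and diff: "dual_norm_frechet_differentiable_at s f"
  obtains e where "norm e \<le> 1" and "f e = 1"
    and "\<And>\<eta>. \<eta> > 0 \<Longrightarrow> \<exists>\<delta>>0. \<forall>y. norm y \<le> 1 \<and> re_part (f y) \<ge> 1 - \<delta> \<longrightarrow> norm (y - e) \<le> \<eta>"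
proof -
  have cont: "continuous_on UNIV (\<lambda>y. re_part (f y))"
    unfolding re_part_def by (auto intro!: continuous_intros)
  define S where "S n = {y. norm y \<le> 1 \<and> re_part (f y) \<ge> 1 - inverse (real (Suc n))}" for n
  have "\<exists>a. \<Inter>(range S) = {a}"
  proof (rule decreasing_closed_nest_sing)
    show "closed (S n)" for n
      unfolding S_def
      by (intro closed_Collect_conj closed_Collect_le continuous_on_const continuous_on_norm
          continuous_on_id cont)
    show "S n \<noteq> {}" for n
      using slice_nonempty[OF s f, of "inverse (Suc n)"] by (auto simp: S_def)
    show "S n \<subseteq> S m" if "m \<le> n" for m n
    proof -
      have "inverse (real (Suc n)) \<le> inverse (real (Suc m))"
        using that by (intro le_imp_inverse_le) auto
      then have "1 - inverse (real (Suc m)) \<le> a" if "1 - inverse (real (Suc n)) \<le> a" for a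
        using that by linarith
      then show ?thesis unfolding S_def by blast
    qed
    fix \<epsilon> :: real assume \<epsilon>: "\<epsilon> > 0"
    then obtain \<delta> where \<delta>: "\<delta> > 0"
      and diam: "\<And>y y'. norm y \<le> 1 \<Longrightarrow> norm y' \<le> 1 \<Longrightarrow> re_part (f y) \<ge> 1 - \<delta> \<Longrightarrow>
           re_part (f y') \<ge> 1 - \<delta> \<Longrightarrow> norm (y - y') \<le> \<epsilon> / 2"
      using slice_diameter_small[OF s f diff, of "\<epsilon> / 2"] by (metis half_gt_zero)
    obtain n where "inverse (real (Suc n)) < \<delta>" using reals_Archimedean[OF \<delta>] by auto
    then show "\<exists>n. \<forall>y\<in>S n. \<forall>y'\<in>S n. dist y y' < \<epsilon>"
      using diam \<epsilon> unfolding S_def dist_norm by (intro exI[of _ n]) fastforce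
  qed
  then obtain e where "\<Inter>(range S) = {e}" by blast
  then have e: "norm e \<le> 1" "\<And>n. re_part (f e) \<ge> 1 - inverse (real (Suc n))"
    by (auto simp: S_def)
  have re: "re_part (f e) \<ge> 1"
  proof (rule ccontr)
    assume "\<not> ?thesis"
    then obtain n where "inverse (real (Suc n)) < 1 - re_part (f e)"
      using reals_Archimedean[of "1 - re_part (f e)"] by auto
    with e(2)[of n] show False by simp
  qed
  show thesis
  proof (rule that[OF e(1)])
    have "norm (f e) \<le> 1"
      using norm_blinfun[of f e] e(1) f(2) by simp
    then show "f e = 1" using re by (rule eq_one_if_re_part_ge_norm)
    fix \<eta> :: real assume "\<eta> > 0"
    then obtain \<delta> where \<delta>: "\<delta> > 0"
      and diam: "\<And>y y'. norm y \<le> 1 \<Longrightarrow> norm y' \<le> 1 \<Longrightarrow> re_part (f y) \<ge> 1 - \<delta> \<Longrightarrow>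
           re_part (f y') \<ge> 1 - \<delta> \<Longrightarrow> norm (y - y') \<le> \<eta>"
      using slice_diameter_small[OF s f diff, of \<eta>] by metis
    then show "\<exists>\<delta>>0. \<forall>y. norm y \<le> 1 \<and> re_part (f y) \<ge> 1 - \<delta> \<longrightarrow> norm (y - e) \<le> \<eta>"
      using e(1) re by (intro exI[of _ \<delta>]) auto
  qed
qed

section \<open>Functionals and operators on the projective tensor product\<close>

context normed_space_over
begin

lemma bounded_linear_scale_right: "bounded_linear (scale a)"
proof (rule bounded_linear_intro)
  show "scale a (x + y) = scale a x + scale a y" for x y by (rule scale_right_distrib)
  show "scale a (r *\<^sub>R x) = r *\<^sub>R scale a x" for r x
    by (simp add: mult.commute flip: scale_of_real)
  show "norm (scale a x) \<le> norm x * norm a" for x by (simp add: norm_scale)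
qed

text \<open>
  A coordinate functional of a basis through \<open>v\<close>, possibly unbounded. Elementary tensors are
  evaluations at arbitrary bilinear forms, so such functionals suffice to compute with them.
\<close>

lemma nonzero_functional:
  assumes "v \<noteq> 0"
  obtains \<psi> where "Vector_Spaces.linear scale (*) \<psi>" and "\<psi> v \<noteq> 0"
proof -
  define B where "B = extend_basis {v}"
  have v: "independent {v}" using assms by (simp add: dependent_single)
  have B: "independent B" "span B = UNIV" "v \<in> B"
    using independent_extend_basis[OF v] span_extend_basis[OF v] extend_basis_superset[OF v]
    by (auto simp: B_def)
  show thesis
    using linear_representation[OF B(1,2), of v] representation_basis[OF B(1,3)] that by simp
qed

end

lemma bilinear_form_simps:
  assumes "bilinear_form sx sy B"
  shows "B (x + x') y = B x y + B x' y" and "B x (y + y') = B x y + B x y'"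
    and "B (sx a x) y = a * B x y" and "B x (sy a y) = a * B x y"
proof -
  have l: "Vector_Spaces.linear sx (*) (\<lambda>x. B x y)" and r: "Vector_Spaces.linear sy (*) (B x)"
    for x y
    using assms by (simp_all add: bilinear_form_def)
  show "B (x + x') y = B x y + B x' y" "B (sx a x) y = a * B x y"
    using linear_over_add[OF l] linear_over_scale[OF l] .
  show "B x (y + y') = B x y + B x y'" "B x (sy a y) = a * B x y"
    using linear_over_add[OF r] linear_over_scale[OF r] .
qed

lemma bilinear_form_mult:
  assumes sx: "normed_space_over sx" and sy: "normed_space_over sy"
    and f: "Vector_Spaces.linear sx (*) f" and g: "Vector_Spaces.linear sy (*) g"
  shows "bilinear_form sx sy (\<lambda>x y. f x * g y)"
  unfolding bilinear_form_def
  by (intro conjI allI linear_overI[OF sx normed_space_over_field]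
      linear_overI[OF sy normed_space_over_field])
    (simp_all add: linear_over_add[OF f] linear_over_scale[OF f] linear_over_add[OF g]
      linear_over_scale[OF g] algebra_simps)

lemma sum_fun_apply: "(\<Sum>i\<in>A. f i) z = (\<Sum>i\<in>A. f i z)"
  by (induction A rule: infinite_finite_induct) auto

lemma vector_space_scale_fun: "vector_space (scale_fun :: 'k::field \<Rightarrow> ('b \<Rightarrow> 'k) \<Rightarrow> 'b \<Rightarrow> 'k)"
  by unfold_locales (auto simp: scale_fun_def algebra_simps)

locale projective_tensor_product =
  X: normed_space_over sx + Y: normed_space_over sy
  for sx :: "'k::real_or_complex \<Rightarrow> 'x::real_normed_vector \<Rightarrow> 'x"
    and sy :: "'k \<Rightarrow> 'y::real_normed_vector \<Rightarrow> 'y" +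
  fixes sz :: "'k \<Rightarrow> 'z::banach \<Rightarrow> 'z" and \<iota> :: "(('x \<Rightarrow> 'y \<Rightarrow> 'k) \<Rightarrow> 'k) \<Rightarrow> 'z"
  assumes projective: "is_projective_tensor_product sx sy sz \<iota>"
begin

abbreviation et :: "'x \<Rightarrow> 'y \<Rightarrow> ('x \<Rightarrow> 'y \<Rightarrow> 'k) \<Rightarrow> 'k"
  where "et \<equiv> elementary_tensor sx sy"

abbreviation V :: "(('x \<Rightarrow> 'y \<Rightarrow> 'k) \<Rightarrow> 'k) set"
  where "V \<equiv> tensor_space sx sy"

abbreviation \<pi> :: "(('x \<Rightarrow> 'y \<Rightarrow> 'k) \<Rightarrow> 'k) \<Rightarrow> real"
  where "\<pi> \<equiv> projective_norm sx sy"

definition tensor :: "'x \<Rightarrow> 'y \<Rightarrow> 'z" (infix "\<otimes>" 75)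
  where "x \<otimes> y = \<iota> (et x y)"

sublocale Z: normed_space_over sz
  using projective by (simp add: is_projective_tensor_product_def is_completion_def)

sublocale F: vector_space "scale_fun :: 'k \<Rightarrow> (('x \<Rightarrow> 'y \<Rightarrow> 'k) \<Rightarrow> 'k) \<Rightarrow> ('x \<Rightarrow> 'y \<Rightarrow> 'k) \<Rightarrow> 'k"
  by (rule vector_space_scale_fun)

lemmas X_over = X.normed_space_over_axioms
lemmas Y_over = Y.normed_space_over_axioms
lemmas Z_over = Z.normed_space_over_axioms

lemma \<iota>_add: "u \<in> V \<Longrightarrow> v \<in> V \<Longrightarrow> \<iota> (u + v) = \<iota> u + \<iota> v"
  and \<iota>_scale: "u \<in> V \<Longrightarrow> \<iota> (scale_fun a u) = sz a (\<iota> u)"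
  and norm_\<iota>: "u \<in> V \<Longrightarrow> norm (\<iota> u) = \<pi> u"
  and \<iota>_dense: "closure (\<iota> ` V) = UNIV"
  using projective by (simp_all add: is_projective_tensor_product_def is_completion_def)

lemma V_closed: "u \<in> V \<Longrightarrow> v \<in> V \<Longrightarrow> u + v \<in> V" "u \<in> V \<Longrightarrow> v \<in> V \<Longrightarrow> u - v \<in> V"
    "u \<in> V \<Longrightarrow> scale_fun a u \<in> V" "0 \<in> V" "et x y \<in> V"
  unfolding tensor_space_def
  by (auto intro: F.span_add F.span_diff F.span_scale F.span_zero F.span_base)

lemma V_sum: "(\<Sum>i<(n::nat). et (x i) (y i)) \<in> V"
  by (induction n) (simp_all only: sum.lessThan_Suc lessThan_0 sum.empty V_closed)

lemma \<iota>_zero: "\<iota> 0 = 0"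
  using \<iota>_add[OF V_closed(4,4)] by simp

lemma \<iota>_diff: "u \<in> V \<Longrightarrow> v \<in> V \<Longrightarrow> \<iota> (u - v) = \<iota> u - \<iota> v"
  using \<iota>_add[of "u - v" v] V_closed(2)[of u v] by (simp add: algebra_simps)

lemma \<iota>_sum: "\<iota> (\<Sum>i<(n::nat). et (x i) (y i)) = (\<Sum>i<n. x i \<otimes> y i)"
  by (induction n)
    (simp_all only: sum.lessThan_Suc lessThan_0 sum.empty \<iota>_zero \<iota>_add V_closed V_sum tensor_def)

lemma et_linear:
  "et (x + x') y = et x y + et x' y" "et x (y + y') = et x y + et x y'"
  "et (sx a x) y = scale_fun a (et x y)" "et x (sy a y) = scale_fun a (et x y)"
  by (auto simp: elementary_tensor_def scale_fun_def fun_eq_iff bilinear_form_simps)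

lemma tensor_linear:
  "(x + x') \<otimes> y = x \<otimes> y + x' \<otimes> y" "x \<otimes> (y + y') = x \<otimes> y + x \<otimes> y'"
  "sx a x \<otimes> y = sz a (x \<otimes> y)" "x \<otimes> sy a y = sz a (x \<otimes> y)"
  by (simp_all add: tensor_def et_linear \<iota>_add \<iota>_scale V_closed)

lemma V_cases:
  assumes "u \<in> V"
  obtains n :: nat and x y where "u = (\<Sum>i<n. et (x i) (y i))"
proof -
  from assms have "\<exists>(n::nat) x y. u = (\<Sum>i<n. et (x i) (y i))"
    unfolding tensor_space_def
  proof (induction rule: F.span_induct_alt)
    case base
    show ?case by (rule exI[of _ 0]) simp
  next
    case (step c v w)
    then obtain a b n x y where v: "v = et a b" and w: "w = (\<Sum>i<(n::nat). et (x i) (y i))"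
      by blast
    have "scale_fun c v + w = (\<Sum>i<Suc n. et ((x(n := sx c a)) i) ((y(n := b)) i))"
      by (simp add: v w et_linear add.commute)
    then show ?case by (intro exI)
  qed
  then show thesis using that by blast
qed

lemma \<pi>_le: "\<pi> (\<Sum>i<(n::nat). et (x i) (y i)) \<le> (\<Sum>i<n. norm (x i) * norm (y i))"
  unfolding projective_norm_def
  by (rule cInf_lower) (auto intro!: bdd_belowI[of _ 0] sum_nonneg)

lemma le_\<pi>:
  assumes u: "u \<in> V" and C: "C \<ge> 0"
    and le: "\<And>(n::nat) x y. u = (\<Sum>i<n. et (x i) (y i)) \<Longrightarrow> r \<le> C * (\<Sum>i<n. norm (x i) * norm (y i))"
  shows "r \<le> C * \<pi> u"
proof (cases "C = 0")
  case True
  then show ?thesis using u le by (auto elim: V_cases)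
next
  case False
  with C have C: "C > 0" by simp
  have "r / C \<le> \<pi> u"
    unfolding projective_norm_def
  proof (rule cInf_greatest)
    show "{\<Sum>i<n. norm (x i) * norm (y i) | (n::nat) x y. u = (\<Sum>i<n. et (x i) (y i))} \<noteq> {}"
      by (rule V_cases[OF u]) blast
  qed (use le C in \<open>auto simp: field_simps\<close>)
  then show ?thesis using C by (simp add: field_simps)
qed

lemma norm_tensor_le: "norm (x \<otimes> y) \<le> norm x * norm y"
  using \<pi>_le[of "\<lambda>_. x" "\<lambda>_. y" 1] by (simp add: tensor_def norm_\<iota> V_closed)

lemma dense_induct:
  assumes "closed {z. P z}" and "\<And>u. u \<in> V \<Longrightarrow> P (\<iota> u)"
  shows "P z"
proof -
  have "closure (\<iota> ` V) \<subseteq> {z. P z}" using assms by (intro closure_minimal) auto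
  then show ?thesis using \<iota>_dense by auto
qed

text \<open>
  The unit ball of the projective tensor product is the closed convex hull of the elementary tensors
  of unit vectors, so an operator norm is already determined by the elementary tensors.
\<close>

lemma norm_le_if_le_on_tensors:
  fixes A :: "'z \<Rightarrow>\<^sub>L 'w::real_normed_vector"
  assumes C: "C \<ge> 0" and le: "\<And>x y. norm (A (x \<otimes> y)) \<le> C * (norm x * norm y)"
  shows "norm A \<le> C"
proof (rule norm_blinfun_bound[OF C])
  fix z
  show "norm (A z) \<le> C * norm z"
  proof (rule dense_induct[of "\<lambda>z. norm (A z) \<le> C * norm z"])
    show "closed {z. norm (A z) \<le> C * norm z}"
      by (intro closed_Collect_le continuous_intros)
    fix u assume u: "u \<in> V"
    have "norm (A (\<iota> u)) \<le> C * \<pi> u"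
    proof (rule le_\<pi>[OF u C])
      fix n :: nat and x y assume "u = (\<Sum>i<n. et (x i) (y i))"
      then have "norm (A (\<iota> u)) = norm (\<Sum>i<n. A (x i \<otimes> y i))"
        by (simp add: \<iota>_sum blinfun.sum_right)
      also have "\<dots> \<le> (\<Sum>i<n. C * (norm (x i) * norm (y i)))"
        by (rule order_trans[OF norm_sum sum_mono[OF le]])
      finally show "norm (A (\<iota> u)) \<le> C * (\<Sum>i<n. norm (x i) * norm (y i))"
        by (simp add: sum_distrib_left)
    qed
    then show "norm (A (\<iota> u)) \<le> C * norm (\<iota> u)" by (simp add: norm_\<iota> u)
  qed
qed

text \<open>
  Applying \<open>g\<close> in the second factor is well defined on the algebraic tensor product, because
  the linear functionals on \<open>X\<close> separate points.
\<close>

lemma tensor_contraction: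
  assumes g: "Vector_Spaces.linear sy (*) g" and eq: "et x e = (\<Sum>i<(n::nat). et (xs i) (ys i))"
  shows "sx (g e) x = (\<Sum>i<n. sx (g (ys i)) (xs i))"
proof (rule ccontr)
  let ?v = "sx (g e) x - (\<Sum>i<n. sx (g (ys i)) (xs i))"
  assume "\<not> ?thesis"
  then have "?v \<noteq> 0" by simp
  then obtain \<psi> where \<psi>: "Vector_Spaces.linear sx (*) \<psi>" "\<psi> ?v \<noteq> 0"
    by (rule X.nonzero_functional)
  interpret \<psi>: Vector_Spaces.linear sx "(*)" \<psi> by (rule \<psi>(1))
  let ?B = "\<lambda>x y. \<psi> x * g y"
  have "bilinear_form sx sy ?B" by (rule bilinear_form_mult[OF X_over Y_over \<psi>(1) g])
  with fun_cong[OF eq, of ?B] have "\<psi> x * g e = (\<Sum>i<n. \<psi> (xs i) * g (ys i))"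
    by (simp add: sum_fun_apply elementary_tensor_def)
  then have "\<psi> ?v = 0" by (simp add: \<psi>.diff \<psi>.sum \<psi>.scale mult.commute)
  with \<psi>(2) show False by simp
qed

text \<open>
  Contraction with \<open>g\<close> recovers \<open>x\<close> from \<open>x \<otimes> e\<close> and does not increase norms.
\<close>

lemma norm_tensor_ge:
  assumes g: "Vector_Spaces.linear sy (*) g" and le: "\<And>y. norm (g y) \<le> norm y" and e: "g e = 1"
  shows "norm x \<le> norm (x \<otimes> e)"
proof -
  have "norm x \<le> 1 * \<pi> (et x e)"
  proof (rule le_\<pi>)
    fix n :: nat and xs ys assume "et x e = (\<Sum>i<n. et (xs i) (ys i))"
    then have "x = (\<Sum>i<n. sx (g (ys i)) (xs i))"
      using tensor_contraction[OF g, where x = x and e = e and xs = xs and ys = ys] e by simp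
    then have "norm x \<le> (\<Sum>i<n. norm (sx (g (ys i)) (xs i)))" using norm_sum by metis
    also have "\<dots> \<le> (\<Sum>i<n. norm (xs i) * norm (ys i))"
      by (intro sum_mono) (simp add: X.norm_scale mult.commute mult_left_mono le)
    finally show "norm x \<le> 1 * (\<Sum>i<n. norm (xs i) * norm (ys i))" by simp
  qed (simp_all add: V_closed)
  then show ?thesis by (simp add: tensor_def norm_\<iota> V_closed)
qed

text \<open>
  On the algebraic tensor product, whose elements are functions of bilinear forms, the functional
  is evaluation at \<open>B\<close>. The bound makes it well defined and Lipschitz on the image of that space in
  the completion, from where it extends by continuity; linearity extends by density.
\<close>

lemma functional_of_bilinear_form:
  assumes B: "bilinear_form sx sy B" and C: "C \<ge> 0"
    and le: "\<And>x y. norm (B x y) \<le> C * (norm x * norm y)"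
  obtains G where "Vector_Spaces.linear sz (*) G" and "\<And>x y. G (x \<otimes> y) = B x y"
    and "\<And>z. norm (G z) \<le> C * norm z"
proof -
  have bound: "norm (u B) \<le> C * norm (\<iota> u)" if u: "u \<in> V" for u
    unfolding norm_\<iota>[OF u]
  proof (rule le_\<pi>[OF u C])
    fix n :: nat and x y assume "u = (\<Sum>i<n. et (x i) (y i))"
    then have "norm (u B) = norm (\<Sum>i<n. B (x i) (y i))"
      by (simp add: sum_fun_apply elementary_tensor_def B)
    also have "\<dots> \<le> (\<Sum>i<n. C * (norm (x i) * norm (y i)))"
      by (rule order_trans[OF norm_sum sum_mono[OF le]])
    finally show "norm (u B) \<le> C * (\<Sum>i<n. norm (x i) * norm (y i))"
      by (simp add: sum_distrib_left)
  qed
  have lipschitz: "dist (u B) (v B) \<le> C * dist (\<iota> u) (\<iota> v)" if "u \<in> V" "v \<in> V" for u v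
    using bound[of "u - v"] that by (simp add: dist_norm V_closed \<iota>_diff)
  \<comment> \<open>any preimage under \<open>\<iota>\<close> serves: by \<open>lipschitz\<close> its value at \<open>B\<close> depends on \<open>z\<close> only\<close>
  define F where "F z = inv_into V \<iota> z B" for z
  have F: "F (\<iota> u) = u B" if u: "u \<in> V" for u
  proof -
    have "inv_into V \<iota> (\<iota> u) \<in> V" "\<iota> (inv_into V \<iota> (\<iota> u)) = \<iota> u"
      using u by (simp_all add: inv_into_into f_inv_into_f)
    then show ?thesis using lipschitz[of "inv_into V \<iota> (\<iota> u)" u] u by (simp add: F_def)
  qed
  have "C-lipschitz_on (\<iota> ` V) F"
    using lipschitz C by (intro lipschitz_onI) (auto simp: F)
  then have "uniformly_continuous_on (\<iota> ` V) F" by (rule lipschitz_on_uniformly_continuous)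
  then obtain G where "uniformly_continuous_on (closure (\<iota> ` V)) G"
      and FG: "\<And>z. z \<in> \<iota> ` V \<Longrightarrow> F z = G z"
    by (rule uniformly_continuous_on_extension_on_closure) blast
  then have cont: "continuous_on UNIV G"
    by (simp add: \<iota>_dense uniformly_continuous_imp_continuous)
  have G: "G (\<iota> u) = u B" if "u \<in> V" for u using FG[of "\<iota> u"] F that by simp
  note G_cont = continuous_on_compose2[OF cont _ subset_UNIV]
  have closed_add: "closed {z. G (z + w) = G z + G w}" "closed {z. G (w + z) = G w + G z}" for w
    by (intro closed_Collect_eq continuous_intros G_cont)+
  have add: "G (z + w) = G z + G w" for z w
  proof (rule dense_induct[of "\<lambda>z. G (z + w) = G z + G w", OF closed_add(1)])
    fix u assume u: "u \<in> V"
    show "G (\<iota> u + w) = G (\<iota> u) + G w"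
    proof (rule dense_induct[of "\<lambda>w. G (\<iota> u + w) = G (\<iota> u) + G w", OF closed_add(2)])
      fix v assume v: "v \<in> V"
      have "G (\<iota> u + \<iota> v) = G (\<iota> (u + v))" using u v by (simp add: \<iota>_add)
      also have "\<dots> = G (\<iota> u) + G (\<iota> v)" using u v by (simp add: G V_closed)
      finally show "G (\<iota> u + \<iota> v) = G (\<iota> u) + G (\<iota> v)" .
    qed
  qed
  have scale: "G (sz a z) = a * G z" for a z
  proof (rule dense_induct[of "\<lambda>z. G (sz a z) = a * G z"])
    have "continuous_on UNIV (\<lambda>z. sz a z)"
      by (rule linear_continuous_on[OF Z.bounded_linear_scale_right])
    then have "continuous_on UNIV (\<lambda>z. G (sz a z))" by (rule G_cont)
    then show "closed {z. G (sz a z) = a * G z}"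
      by (rule closed_Collect_eq) (intro continuous_on_mult_left cont)
    fix u assume u: "u \<in> V"
    have "G (sz a (\<iota> u)) = G (\<iota> (scale_fun a u))" using u by (simp add: \<iota>_scale)
    also have "\<dots> = a * G (\<iota> u)" using u by (simp add: G V_closed) (simp add: scale_fun_def)
    finally show "G (sz a (\<iota> u)) = a * G (\<iota> u)" .
  qed
  have le_norm: "norm (G z) \<le> C * norm z" for z
  proof (rule dense_induct[of "\<lambda>z. norm (G z) \<le> C * norm z"])
    show "closed {z. norm (G z) \<le> C * norm z}"
      by (intro closed_Collect_le continuous_intros G_cont)
  qed (simp add: G bound)
  have "Vector_Spaces.linear sz (*) G"
    by (rule linear_overI[OF Z_over normed_space_over_field]) (simp_all only: add scale)
  moreover have "G (x \<otimes> y) = B x y" for x y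
    by (simp add: tensor_def G V_closed) (simp add: elementary_tensor_def B)
  ultimately show thesis using le_norm that by blast
qed

end

lemma (in normed_space_over) nonzero_if_dim_range_eq_1:
  assumes "dim (range T) = 1"
  obtains x where "T x \<noteq> 0"
proof (rule ccontr)
  assume "\<not> thesis"
  then have "T x = 0" for x using that by blast
  then have "range T = {0}" by auto
  then show False using assms dim_span[of "{}"] dim_eq_card_independent[OF independent_empty] by simp
qed

lemma (in normed_space_over) rank_one_factorization:
  assumes T: "Vector_Spaces.linear scale scale T" and dim: "dim (range T) = 1"
  obtains f v where "Vector_Spaces.linear scale (*) f" and "v \<noteq> 0" and "\<And>x. T x = scale (f x) v"
proof -
  obtain B where B: "independent B" "range T \<subseteq> span B" "card B = dim (range T)"
    by (rule basis_exists)
  then obtain v where v: "B = {v}" using dim card_1_singletonE by metis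
  then have "v \<noteq> 0" using B(1) dependent_zero by blast
  have "\<exists>a. T x = scale a v" for x
    using B(2) by (auto simp: v span_singleton)
  then obtain f where f: "\<And>x. T x = scale (f x) v" by metis
  have "scale (f (x + y)) v = scale (f x + f y) v" "scale (f (scale a x)) v = scale (a * f x) v"
    for x y a
    by (simp_all only: scale_left_distrib flip: f scale_scale)
      (simp_all add: linear_over_add[OF T] linear_over_scale[OF T])
  then have "Vector_Spaces.linear scale (*) f"
    using \<open>v \<noteq> 0\<close>
    by (intro linear_overI[OF normed_space_over_axioms normed_space_over_field]) simp_all
  with \<open>v \<noteq> 0\<close> f that show thesis by blast
qed

text \<open>
  If \<open>T x = f x v\<close>, then \<open>S\<close> multiplies \<open>v \<otimes> e\<close> by the functional that extends \<open>f x * g y\<close>. On the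
  isometric copy \<open>X \<otimes> e\<close> of \<open>X\<close> the operator \<open>S\<close> acts as \<open>T\<close>, whence the norm estimate.
\<close>

lemma (in projective_tensor_product) rank_one_tensor_operator:
  fixes T :: "'x \<Rightarrow>\<^sub>L 'x" and g :: "'y \<Rightarrow>\<^sub>L 'k"
  assumes T: "Vector_Spaces.linear sx sx T" "X.dim (range T) = 1"
    and g: "g \<in> topological_dual sy" "norm g \<le> 1" and e: "norm e \<le> 1" "g e = 1"
  obtains S where "Vector_Spaces.linear sz sz (blinfun_apply S)"
    and "Z.dim (range (blinfun_apply S)) = 1"
    and "\<And>x y. blinfun_apply S (x \<otimes> y) = sz (g y) (T x \<otimes> e)" and "norm T \<le> norm S"
proof -
  obtain f v where f: "Vector_Spaces.linear sx (*) f" and v: "v \<noteq> 0" and Tf: "\<And>x. T x = sx (f x) v"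
    using X.rank_one_factorization[OF T] by blast
  have glin: "Vector_Spaces.linear sy (*) g" using g(1) by (simp add: topological_dual_def)
  have gle: "norm (g y) \<le> norm y" for y
    using norm_blinfun[of g y] mult_right_mono[OF g(2), of "norm y"] by simp
  have fle: "norm (f x) \<le> norm T / norm v * norm x" for x
    using norm_blinfun[of T x] v by (simp add: Tf X.norm_scale field_simps)
  let ?C = "norm T / norm v"
  have "norm (f x * g y) \<le> ?C * (norm x * norm y)" for x y
    using mult_mono[OF fle gle, of x y] by (simp add: norm_mult mult.assoc)
  then obtain G where G: "Vector_Spaces.linear sz (*) G" "\<And>x y. G (x \<otimes> y) = f x * g y"
      "\<And>z. norm (G z) \<le> ?C * norm z"
    using functional_of_bilinear_form[OF bilinear_form_mult[OF X_over Y_over f glin], of ?C] by auto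
  define w where "w = v \<otimes> e"
  have w: "w \<noteq> 0" using norm_tensor_ge[OF glin gle e(2), of v] v by (auto simp: w_def)
  let ?S = "\<lambda>z. sz (G z) w"
  have S_lin: "Vector_Spaces.linear sz sz ?S"
    by (rule linear_overI[OF Z_over Z_over])
      (simp_all add: linear_over_add[OF G(1)] linear_over_scale[OF G(1)] Z.scale_left_distrib)
  have "norm (?S z) \<le> (?C * norm w) * norm z" for z
    using mult_right_mono[OF G(3), of "norm w" z] by (simp add: Z.norm_scale mult_ac)
  then have "bounded_linear ?S" by (rule bounded_linear_overI[OF Z_over Z_over S_lin])
  then have app: "blinfun_apply (Blinfun ?S) = ?S" by (rule bounded_linear_Blinfun_apply)
  have on_tensor: "?S (x \<otimes> y) = sz (g y) (T x \<otimes> e)" for x y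
    by (simp add: G(2) Tf tensor_linear w_def mult.commute)
  obtain x where "f x \<noteq> 0"
    using X.nonzero_if_dim_range_eq_1[OF T(2)] by (metis Tf X.scale_zero_left)
  then have "range ?S = range (\<lambda>a. sz a w)"
  proof (intro equalityI subsetI)
    fix z assume "z \<in> range (\<lambda>a. sz a w)"
    then obtain a where "z = sz a w" by blast
    also have "\<dots> = ?S (sz (a / f x) (x \<otimes> e))"
      using \<open>f x \<noteq> 0\<close> by (simp add: linear_over_scale[OF G(1)] G(2) e)
    finally show "z \<in> range ?S" by blast
  qed auto
  then have "range ?S = Z.span {w}" by (simp add: Z.span_singleton)
  moreover have "Z.independent {w}" using w by (simp add: Z.dependent_single)
  ultimately have dim: "Z.dim (range ?S) = 1" by (simp add: Z.dim_eq_card_independent)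
  have "norm T \<le> norm (Blinfun ?S)"
  proof (rule norm_blinfun_bound)
    fix x
    have "norm (T x) \<le> norm (T x \<otimes> e)" by (rule norm_tensor_ge[OF glin gle e(2)])
    also have "\<dots> = norm (Blinfun ?S (x \<otimes> e))" by (simp only: app on_tensor e(2)) simp
    also have "\<dots> \<le> norm (Blinfun ?S) * norm (x \<otimes> e)" by (rule norm_blinfun)
    also have "\<dots> \<le> norm (Blinfun ?S) * norm x"
      using norm_tensor_le[of x e] mult_left_le[OF e(1), of "norm x"]
      by (intro mult_left_mono) auto
    finally show "norm (T x) \<le> norm (Blinfun ?S) * norm x" .
  qed simp
  then show thesis using S_lin dim on_tensor by (intro that[of "Blinfun ?S"]) (simp_all add: app)
qed

section \<open>The Daugavet equation\<close>

theorem proposition4p5: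
  fixes sx :: "'k::real_or_complex \<Rightarrow> 'x::banach \<Rightarrow> 'x"
    and sy :: "'k \<Rightarrow> 'y::banach \<Rightarrow> 'y"
    and sz :: "'k \<Rightarrow> 'z::banach \<Rightarrow> 'z"
    and \<iota> :: "(('x \<Rightarrow> 'y \<Rightarrow> 'k) \<Rightarrow> 'k) \<Rightarrow> 'z"
    and y0 :: "'y \<Rightarrow>\<^sub>L 'k"
  assumes "normed_space_over sx" and "normed_space_over sy"
    and "is_projective_tensor_product sx sy sz \<iota>"
    and "daugavet_property sz"
    and "y0 \<in> topological_dual sy" and "norm y0 = 1"
    and "dual_norm_frechet_differentiable_at sy y0"
  shows "daugavet_property sx"
  unfolding daugavet_property_def
proof (intro allI impI, elim conjE)
  fix T :: "'x \<Rightarrow>\<^sub>L 'x"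
  assume T: "Vector_Spaces.linear sx sx T" "vector_space.dim sx (range T) = 1"
  interpret projective_tensor_product sx sy sz \<iota>
    by (intro projective_tensor_product.intro projective_tensor_product_axioms.intro assms(1-3))
  have y0_lin: "Vector_Spaces.linear sy (*) y0" using assms(5) by (simp add: topological_dual_def)
  obtain e where e: "norm e \<le> 1" "y0 e = 1"
    and exposed: "\<And>\<eta>. \<eta> > 0 \<Longrightarrow>
          \<exists>\<delta>>0. \<forall>y. norm y \<le> 1 \<and> re_part (y0 y) \<ge> 1 - \<delta> \<longrightarrow> norm (y - e) \<le> \<eta>"
    using frechet_smooth_point_strongly_exposes[OF assms(2,5,6,7)] by metis
  obtain S where S: "Vector_Spaces.linear sz sz (blinfun_apply S)"
      "Z.dim (range (blinfun_apply S)) = 1"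
    and S_tensor: "\<And>x y. blinfun_apply S (x \<otimes> y) = sz (y0 y) (T x \<otimes> e)"
    and norm_S: "norm T \<le> norm S"
    using rank_one_tensor_operator[OF T assms(5) _ e] assms(6) by auto
  have daugavet: "norm (id_blinfun + S) = 1 + norm S"
    using assms(4) S by (simp add: daugavet_property_def)
  show "norm (id_blinfun + T) = 1 + norm T"
  proof (rule ccontr)
    assume "\<not> ?thesis"
    moreover have "norm (id_blinfun + T) \<le> 1 + norm T"
      using norm_triangle_ineq[of id_blinfun T] norm_blinfun_id_le[where 'a = 'x] by linarith
    ultimately have gap: "norm (id_blinfun + T) < 1 + norm T" by simp
    \<comment> \<open>a third of the gap: two errors of size \<open>\<eta>\<close> for \<open>y\<close> near \<open>e\<close> still leave \<open>\<eta>\<close> to spare\<close>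
    define \<eta> where "\<eta> = (1 + norm T - norm (id_blinfun + T)) / 3"
    have \<eta>: "\<eta> > 0" using gap by (simp add: \<eta>_def)
    obtain \<delta>0 where \<delta>0: "\<delta>0 > 0"
      and near: "\<And>y. norm y \<le> 1 \<Longrightarrow> re_part (y0 y) \<ge> 1 - \<delta>0 \<Longrightarrow> norm (y - e) \<le> \<eta>"
      using exposed[OF \<eta>] by blast
    obtain x where "T x \<noteq> 0" using X.nonzero_if_dim_range_eq_1[OF T(2)] by blast
    then have "norm T > 0" by auto
    \<comment> \<open>\<open>\<delta>\<close> serves the slice around \<open>e\<close> and also absorbs the error from replacing \<open>y0 y\<close> by 1\<close>
    define \<delta> where "\<delta> = min \<delta>0 (\<eta> / norm T)"
    have \<delta>: "\<delta> > 0" "\<delta> \<le> \<delta>0" "\<delta> * norm T \<le> \<eta>"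
      using \<delta>0 \<eta> \<open>norm T > 0\<close> by (auto simp: \<delta>_def min_def field_simps)
    \<comment> \<open>the first entry bounds tensors with \<open>y0 y\<close> away from 1, the second those with \<open>y\<close> near \<open>e\<close>\<close>
    define c where "c = max (1 + norm T - \<delta> * norm T) (1 + norm T - \<eta>)"
    have c: "c < 1 + norm T" "1 + norm T - \<delta> * norm T \<le> c" "1 + norm T - \<eta> \<le> c"
      using \<delta>(1) \<eta> \<open>norm T > 0\<close> by (auto simp: c_def)
    have three_\<eta>: "3 * \<eta> = 1 + norm T - norm (id_blinfun + T)" by (simp add: \<eta>_def)
    have "c \<ge> 0"
      using c(3) three_\<eta> \<eta> norm_ge_zero[of "id_blinfun + T"] norm_ge_zero[of T] by linarith
    have unit: "norm ((id_blinfun + S) (x \<otimes> y)) \<le> c * norm x"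
      if y: "norm y = 1" and s: "y0 y = of_real s" "s \<ge> 0" for x y s
    proof -
      have eq: "(id_blinfun + S) (x \<otimes> y) = x \<otimes> y + s *\<^sub>R (T x \<otimes> e)"
        by (simp add: blinfun.add_left S_tensor s Z.scale_of_real)
      have xy: "norm (x \<otimes> y) \<le> norm x" using norm_tensor_le[of x y] y by simp
      have Te: "norm (T x \<otimes> e) \<le> norm T * norm x"
        using norm_tensor_le[of "T x" e] mult_left_le[OF e(1), of "norm (T x)"] norm_blinfun[of T x]
        by simp
      have "s \<le> 1" using norm_blinfun[of y0 y] y s assms(6) by simp
      show ?thesis
      proof (cases "s \<le> 1 - \<delta>")
        case True
        have "norm ((id_blinfun + S) (x \<otimes> y)) \<le> norm (x \<otimes> y) + s * norm (T x \<otimes> e)"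
          unfolding eq using norm_triangle_ineq[of "x \<otimes> y" "s *\<^sub>R (T x \<otimes> e)"] s(2) by simp
        also have "\<dots> \<le> norm x + (1 - \<delta>) * (norm T * norm x)"
          using True s(2) Te xy by (intro add_mono mult_mono) auto
        also have "\<dots> = (1 + norm T - \<delta> * norm T) * norm x" by (simp add: algebra_simps)
        also have "\<dots> \<le> c * norm x" using c(2) by (intro mult_right_mono) auto
        finally show ?thesis .
      next
        case False
        then have close: "norm (y - e) \<le> \<eta>" using near[of y] y s \<delta>(2) by simp
        have "x \<otimes> y = x \<otimes> (e + (y - e))" by simp
        also have "\<dots> = x \<otimes> e + x \<otimes> (y - e)" by (rule tensor_linear)
        finally have "(id_blinfun + S) (x \<otimes> y) =
            (x + T x) \<otimes> e + x \<otimes> (y - e) - (1 - s) *\<^sub>R (T x \<otimes> e)"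
          unfolding eq tensor_linear by (simp add: algebra_simps)
        then have "norm ((id_blinfun + S) (x \<otimes> y)) \<le>
            norm ((x + T x) \<otimes> e) + norm (x \<otimes> (y - e)) + (1 - s) * norm (T x \<otimes> e)"
          using norm_triangle_ineq4[of "(x + T x) \<otimes> e + x \<otimes> (y - e)" "(1 - s) *\<^sub>R (T x \<otimes> e)"]
            norm_triangle_ineq[of "(x + T x) \<otimes> e" "x \<otimes> (y - e)"] \<open>s \<le> 1\<close> by simp
        also have "\<dots> \<le> norm (id_blinfun + T) * norm x + \<eta> * norm x + \<delta> * (norm T * norm x)"
        proof (intro add_mono)
          have "norm ((x + T x) \<otimes> e) \<le> norm ((id_blinfun + T) x)"
            using norm_tensor_le[of "x + T x" e] mult_left_le[OF e(1), of "norm (x + T x)"]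
            by (simp add: blinfun.add_left)
          then show "norm ((x + T x) \<otimes> e) \<le> norm (id_blinfun + T) * norm x"
            using norm_blinfun order_trans by blast
          show "norm (x \<otimes> (y - e)) \<le> \<eta> * norm x"
            using norm_tensor_le[of x "y - e"] mult_left_mono[OF close, of "norm x"]
            by (simp add: mult.commute)
          show "(1 - s) * norm (T x \<otimes> e) \<le> \<delta> * (norm T * norm x)"
            using False Te \<open>s \<le> 1\<close> \<delta>(1) by (intro mult_mono) auto
        qed
        also have "\<dots> = (norm (id_blinfun + T) + \<eta> + \<delta> * norm T) * norm x"
          by (simp add: algebra_simps)
        also have "\<dots> \<le> c * norm x"
          using c(3) \<delta>(3) three_\<eta> by (intro mult_right_mono) (linarith | simp)+
        finally show ?thesis .
      qed
    qed
    have "norm (id_blinfun + S) \<le> c"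
    proof (rule norm_le_if_le_on_tensors[OF \<open>c \<ge> 0\<close>])
      fix x y
      show "norm ((id_blinfun + S) (x \<otimes> y)) \<le> c * (norm x * norm y)"
      proof (cases "y = 0")
        case True
        then have "x \<otimes> y = 0" using norm_tensor_le[of x y] by simp
        then show ?thesis using True by (simp add: blinfun.zero_right)
      next
        case False
        obtain \<theta> where \<theta>: "norm \<theta> = 1" "\<theta> * y0 y = of_real (norm (y0 y))"
          by (rule rotation_to_norm)
        \<comment> \<open>rescaled by \<open>a\<close>, \<open>y\<close> becomes the unit vector \<open>y'\<close> at which \<open>y0\<close> is nonnegative\<close>
        define a where "a = of_real (norm y) / \<theta>"
        define y' where "y' = sy (\<theta> / of_real (norm y)) y"
        have "\<theta> \<noteq> 0" using \<theta>(1) by auto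
        then have y: "y = sy a y'" using False by (simp add: a_def y'_def)
        have a: "norm a = norm y" by (simp add: a_def norm_divide \<theta>)
        have "norm y' = 1" using False by (simp add: y'_def Y.norm_scale norm_divide \<theta>)
        moreover have "y0 y' = of_real (norm (y0 y) / norm y)"
          using \<theta>(2) by (simp add: y'_def linear_over_scale[OF y0_lin])
        ultimately have le: "norm ((id_blinfun + S) (x \<otimes> y')) \<le> c * norm x"
          by (rule unit) simp
        have "(id_blinfun + S) (x \<otimes> y) = sz a ((id_blinfun + S) (x \<otimes> y'))"
          unfolding y tensor_linear
          by (simp add: blinfun.add_left linear_over_scale[OF S(1)] Z.scale_right_distrib)
        then have "norm ((id_blinfun + S) (x \<otimes> y)) = norm y * norm ((id_blinfun + S) (x \<otimes> y'))"
          by (simp only: Z.norm_scale a)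
        also have "\<dots> \<le> norm y * (c * norm x)" using le by (intro mult_left_mono) auto
        finally show ?thesis by (simp add: mult_ac)
      qed
    qed
    with daugavet norm_S c(1) show False by simp
  qed
qed

end
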